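(* Fix $a,b,c,d\in\mathbb R$. For real $\hat t\ge 0$ let $\mathcal A^{[\hat t]}$ be the $2$-dimensional real algebra with the structural constants $c_{ijk}^{[\hat t]}$ given in the context. For $\alpha\in[-1,1]$ let $\mathcal A_\alpha$ denote the algebra $\mathcal A^{[\hat t]}$ for $\hat t\ge 0$ with $\sin\hat t=\alpha$. Then the discrete time flow $\{\mathcal A^{[n]}: n\in\mathbb N\}$ is dense in the set $\{\mathcal A_\alpha:\alpha\in[-1,1]\}$ of algebras, i.e. for every $\alpha\in[-1,1]$ (and every choice of $\hat t\ge0$ with $\sin\hat t=\alpha$ defining $\mathcal A_\alpha$) there exists a sequence $\{n_k\}_{k=1,2,\dots}$ of natural numbers such that $\lim_{k\to\infty}\mathcal A^{[n_k]}=\mathcal A_\alpha$.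
   Context: The algebra $\mathcal A^{[\hat t]}$ has basis $e_1,e_2$ and multiplication $e_ie_j=\sum_{k=1}^2 c_{ijk}^{[\hat t]}e_k$, where \[c_{111}^{[\hat t]}=a\cos\hat t-b\sin\hat t,\quad c_{112}^{[\hat t]}=b\cos\hat t+a\sin\hat t,\quad c_{121}^{[\hat t]}=(1-a)\cos\hat t+b\sin\hat t,\quad c_{122}^{[\hat t]}=-b\cos\hat t+(1-a)\sin\hat t,\] \[c_{211}^{[\hat t]}=c\cos\hat t-d\sin\hat t,\quad c_{212}^{[\hat t]}=d\cos\hat t+c\sin\hat t,\quad c_{221}^{[\hat t]}=-c\cos\hat t-(1-d)\sin\hat t,\quad c_{222}^{[\hat t]}=(1-d)\cos\hat t-c\sin\hat t.\] Convergence of algebras means convergence of all structural constants with respect to the basis $e_1,e_2$. *)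

theory Defs
  imports "HOL-Analysis.Analysis"
begin

text \<open>
  A 2-dimensional real algebra on the space spanned by $e_1, e_2$ is given by its multiplication,
  a bilinear map on \<^typ>\<open>real^2\<close>, where $e_i$ is the standard basis vector
  \<^term>\<open>axis i 1\<close>.
\<close>

type_synonym alg2 = "real^2 \<Rightarrow> real^2 \<Rightarrow> real^2"

definition unit_vec :: "2 \<Rightarrow> real^2" where
  "unit_vec i = axis i 1"

definition struct_const :: "alg2 \<Rightarrow> 2 \<Rightarrow> 2 \<Rightarrow> 2 \<Rightarrow> real" where
  "struct_const A i j k = A (unit_vec i) (unit_vec j) $ k"

definition alg_of_consts :: "real^2^2^2 \<Rightarrow> alg2" where
  "alg_of_consts C x y =
     (\<Sum>i\<in>UNIV. \<Sum>j\<in>UNIV. (x $ i * y $ j) *\<^sub>R (\<Sum>k\<in>UNIV. (C $ i $ j $ k) *\<^sub>R unit_vec k))"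

definition alg_converges :: "(nat \<Rightarrow> alg2) \<Rightarrow> alg2 \<Rightarrow> bool" where
  "alg_converges A B \<longleftrightarrow>
     (\<forall>i j k. (\<lambda>m. struct_const (A m) i j k) \<longlonglongrightarrow> struct_const B i j k)"

definition flow_consts :: "real \<Rightarrow> real \<Rightarrow> real \<Rightarrow> real \<Rightarrow> real \<Rightarrow> real^2^2^2" where
  "flow_consts a b c d t =
     vector [
       vector [vector [a * cos t - b * sin t, b * cos t + a * sin t],
               vector [(1 - a) * cos t + b * sin t, - b * cos t + (1 - a) * sin t]],
       vector [vector [c * cos t - d * sin t, d * cos t + c * sin t],
               vector [- c * cos t - (1 - d) * sin t, (1 - d) * cos t - c * sin t]]]"

definition flow_alg :: "real \<Rightarrow> real \<Rightarrow> real \<Rightarrow> real \<Rightarrow> real \<Rightarrow> alg2" where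
  "flow_alg a b c d t = alg_of_consts (flow_consts a b c d t)"

text \<open>
  The value $\sin t = \alpha$ does not determine $\cos t$, hence in general it does not determine
  the algebra at time $t$; the following is the set of all algebras that can arise from
  a choice of $t$.
\<close>

definition sin_algs :: "real \<Rightarrow> real \<Rightarrow> real \<Rightarrow> real \<Rightarrow> real \<Rightarrow> alg2 set" where
  "sin_algs a b c d \<alpha> = {flow_alg a b c d t | t. t \<ge> 0 \<and> sin t = \<alpha>}"

lemma bilinear_alg_of_consts: "bilinear (alg_of_consts C)"
  unfolding bilinear_def alg_of_consts_def
  by (auto intro!: linearI simp: sum_2 algebra_simps)

lemma alg_of_consts_basis:
  "alg_of_consts C (unit_vec i) (unit_vec j) = (\<Sum>k\<in>UNIV. (C $ i $ j $ k) *\<^sub>R unit_vec k)"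
  using exhaust_2[of i] exhaust_2[of j]
  by (auto simp: alg_of_consts_def sum_2 unit_vec_def axis_def)

lemma struct_const_alg_of_consts: "struct_const (alg_of_consts C) i j k = C $ i $ j $ k"
  using exhaust_2[of k]
  unfolding struct_const_def alg_of_consts_basis
  by (auto simp: sum_2 unit_vec_def axis_def)

end

theory Submission
  imports Defs
begin

text \<open>
  Every structural constant of \<open>flow_alg a b c d t\<close> is a fixed linear combination of \<open>cos t\<close> and
  \<open>sin t\<close>. So it is enough to find, for every real \<open>t\<close>, natural numbers \<open>n\<^sub>k\<close> whose classes modulo
  \<open>2\<pi>\<close> converge to that of \<open>t\<close>. By Kronecker's theorem the multiples \<open>n / (2\<pi>)\<close> are dense modulo
  \<open>1\<close> as soon as \<open>\<pi>\<close> is irrational, and this arithmetic fact is the heart of the matter: for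
  rational \<open>\<pi>\<close> the integers would meet only finitely many classes modulo \<open>2\<pi>\<close>.

  Irrationality is proved with the integrals \<open>I\<^sub>n\<close> of \<open>(x (\<pi> - x))\<^sup>n / n! \<cdot> sin x\<close> over \<open>[0, \<pi>]\<close>,
  as in Niven's proof. They satisfy \<open>I\<^sub>0 = 2\<close>, \<open>I\<^sub>1 = 4\<close> and a three-term recurrence
  (\<open>niven_integral_rec\<close>) whose coefficients are integer polynomials in \<open>n\<close> and \<open>\<pi>\<^sup>2\<close>. If \<open>\<pi> = p / q\<close>,
  the recurrence makes every \<open>q\<^sup>n I\<^sub>n\<close> an integer. But \<open>q\<^sup>n I\<^sub>n\<close> is positive, and the factorial drives
  it to \<open>0\<close>, which is impossible for integers.
\<close>

definition niven_poly :: "nat \<Rightarrow> real \<Rightarrow> real" where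
  "niven_poly n x = (x * (pi - x)) ^ n / fact n"

definition niven_integral :: "nat \<Rightarrow> real" where
  "niven_integral n = integral {0..pi} (\<lambda>x. niven_poly n x * sin x)"

lemma continuous_on_niven: "continuous_on A (\<lambda>x. niven_poly n x * sin x)"
  unfolding niven_poly_def by (intro continuous_intros) auto

lemma niven_integrable: "(\<lambda>x. niven_poly n x * sin x) integrable_on {0..pi}"
  by (intro integrable_continuous_real continuous_on_niven)

lemma deriv_niven_poly_Suc:
  "(niven_poly (Suc n) has_real_derivative niven_poly n x * (pi - 2 * x)) (at x)"
proof -
  have "((\<lambda>x. x * (pi - x)) has_real_derivative pi - 2 * x) (at x)"
    by (auto intro!: derivative_eq_intros)
  from DERIV_cdivide [OF DERIV_power_Suc [OF this]]
  have "(niven_poly (Suc n) has_real_derivative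
      (1 + real n) * ((pi - 2 * x) * (x * (pi - x)) ^ n) / fact (Suc n)) (at x)"
    unfolding niven_poly_def [abs_def] .
  also have "(1 + real n) * ((pi - 2 * x) * (x * (pi - x)) ^ n) / fact (Suc n)
      = niven_poly n x * (pi - 2 * x)"
    unfolding niven_poly_def fact_Suc of_nat_Suc by simp
  finally show ?thesis .
qed

lemma niven_poly_boundary:
  "niven_poly (Suc n) 0 = 0" "niven_poly (Suc n) pi = 0"
  by (simp_all add: niven_poly_def)

text \<open>
  Two integrations by parts at once: if \<open>D\<close> is the derivative of \<open>niven_poly (Suc n)\<close> and \<open>h\<close> that of
  \<open>D\<close>, then \<open>D sin - niven_poly (Suc n) cos\<close> is an antiderivative of
  \<open>(h + niven_poly (Suc n)) sin\<close>, and it vanishes at both ends of the interval.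
\<close>

lemma niven_by_parts:
  assumes "\<And>x. ((\<lambda>x. niven_poly n x * (pi - 2 * x)) has_real_derivative h x) (at x)"
  shows "((\<lambda>x. h x * sin x + niven_poly (Suc n) x * sin x) has_integral 0) {0..pi}"
proof -
  let ?F = "\<lambda>x. niven_poly n x * (pi - 2 * x) * sin x - niven_poly (Suc n) x * cos x"
  have "(?F has_real_derivative (h x * sin x + niven_poly (Suc n) x * sin x)) (at x)" for x
    by (rule derivative_eq_intros assms deriv_niven_poly_Suc refl)+ (simp add: algebra_simps)
  then have "((\<lambda>x. h x * sin x + niven_poly (Suc n) x * sin x) has_integral (?F pi - ?F 0)) {0..pi}"
    by (intro fundamental_theorem_of_calculus)
       (auto simp: has_real_derivative_iff_has_vector_derivative [symmetric]
             intro: has_field_derivative_at_within)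
  then show ?thesis
    by (simp add: niven_poly_boundary)
qed

lemma niven_integral_0: "niven_integral 0 = 2"
proof -
  have "((\<lambda>x. sin x) has_integral (- cos pi - - cos 0)) {0..pi}"
    by (intro fundamental_theorem_of_calculus)
       (auto simp: has_real_derivative_iff_has_vector_derivative [symmetric]
             intro!: derivative_eq_intros)
  then show ?thesis
    by (simp add: niven_integral_def niven_poly_def integral_unique)
qed

lemma niven_integral_1: "niven_integral 1 = 4"
proof -
  have "((\<lambda>x. niven_poly 0 x * (pi - 2 * x)) has_real_derivative - 2 * niven_poly 0 x) (at x)" for x
    unfolding niven_poly_def by (auto intro!: derivative_eq_intros)
  from niven_by_parts [OF this]
  have "integral {0..pi} (\<lambda>x. - 2 * (niven_poly 0 x * sin x) + niven_poly 1 x * sin x) = 0"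
    by (simp add: integral_unique mult.assoc)
  moreover have "integral {0..pi} (\<lambda>x. - 2 * (niven_poly 0 x * sin x) + niven_poly 1 x * sin x)
      = - 2 * niven_integral 0 + niven_integral 1"
    unfolding niven_integral_def
    by (simp add: integral_diff integrable_on_mult_right niven_integrable
        del: One_nat_def)
  ultimately show ?thesis
    by (simp add: niven_integral_0)
qed

text \<open>
  With \<open>u = x (\<pi> - x)\<close> one has \<open>u'\<^sup>2 = \<pi>\<^sup>2 - 4 u\<close> and \<open>u'' = -2\<close>, so the second derivative of
  \<open>u\<^sup>n / n!\<close> is again a combination of the same polynomials, of index \<open>n - 1\<close> and \<open>n - 2\<close>.
\<close>

lemma niven_integral_rec:
  "niven_integral (Suc (Suc n))
     = (4 * real n + 6) * niven_integral (Suc n) - pi\<^sup>2 * niven_integral n"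
proof -
  have step: "x * (pi - x) * niven_poly n x = real (Suc n) * niven_poly (Suc n) x" for x
    unfolding niven_poly_def fact_Suc
    by (simp only: of_nat_mult of_nat_fact power_Suc) (simp del: of_nat_Suc)
  have "((\<lambda>x. niven_poly (Suc n) x * (pi - 2 * x)) has_real_derivative
      (pi\<^sup>2 * niven_poly n x - (4 * real n + 6) * niven_poly (Suc n) x)) (at x)" for x
  proof -
    have "((\<lambda>x. niven_poly (Suc n) x * (pi - 2 * x)) has_real_derivative
        niven_poly n x * (pi - 2 * x) * (pi - 2 * x) - 2 * niven_poly (Suc n) x) (at x)"
      by (rule derivative_eq_intros deriv_niven_poly_Suc refl)+ simp
    also have "niven_poly n x * (pi - 2 * x) * (pi - 2 * x)
        = pi\<^sup>2 * niven_poly n x - 4 * (x * (pi - x) * niven_poly n x)"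
      by (simp add: algebra_simps power2_eq_square)
    finally show ?thesis
      unfolding step by (simp add: algebra_simps)
  qed
  from niven_by_parts [OF this]
  have "integral {0..pi} (\<lambda>x. pi\<^sup>2 * (niven_poly n x * sin x)
      - (4 * real n + 6) * (niven_poly (Suc n) x * sin x) + niven_poly (Suc (Suc n)) x * sin x) = 0"
    by (simp add: integral_unique left_diff_distrib mult.assoc)
  moreover have "integral {0..pi} (\<lambda>x. pi\<^sup>2 * (niven_poly n x * sin x)
      - (4 * real n + 6) * (niven_poly (Suc n) x * sin x) + niven_poly (Suc (Suc n)) x * sin x)
      = pi\<^sup>2 * niven_integral n - (4 * real n + 6) * niven_integral (Suc n)
        + niven_integral (Suc (Suc n))"
    unfolding niven_integral_def
    by (simp add: integral_add integral_diff integrable_diff integrable_on_mult_right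
        niven_integrable)
  ultimately show ?thesis
    by simp
qed

lemma niven_integral_pos: "niven_integral n > 0"
proof -
  have "integral {0..pi} (\<lambda>x. 0) < niven_integral n"
    unfolding niven_integral_def
  proof (rule integral_less_real)
    show "0 < niven_poly n x * sin x" if "x \<in> {0<..<pi}" for x
      using that sin_gt_zero [of x] by (simp add: niven_poly_def)
  qed (auto intro: continuous_on_niven simp: not_le)
  then show ?thesis
    by simp
qed

lemma niven_integral_le: "niven_integral n \<le> pi * ((pi\<^sup>2) ^ n / fact n)"
proof -
  have "niven_poly n x * sin x \<le> (pi\<^sup>2) ^ n / fact n" if "x \<in> {0..pi}" for x
  proof -
    have "x * (pi - x) \<le> pi\<^sup>2"
      unfolding power2_eq_square using that by (intro mult_mono) auto
    then have "niven_poly n x \<le> (pi\<^sup>2) ^ n / fact n"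
      unfolding niven_poly_def using that by (intro divide_right_mono power_mono) auto
    moreover have "niven_poly n x * sin x \<le> niven_poly n x * 1"
      using that by (intro mult_left_mono) (auto simp: niven_poly_def)
    ultimately show ?thesis
      by simp
  qed
  then have "niven_integral n \<le> integral {0..pi} (\<lambda>x. (pi\<^sup>2) ^ n / fact n)"
    unfolding niven_integral_def by (intro integral_le niven_integrable) auto
  then show ?thesis
    by simp
qed

theorem pi_irrational: "pi \<notin> \<rat>"
proof
  assume "pi \<in> \<rat>"
  then obtain p q :: int where q: "q > 0" and pq: "pi = of_int p / of_int q"
    by (meson Rats_cases')
  have p: "of_int p = of_int q * pi"
    using q by (subst pq) simp
  have int: "of_int q ^ n * niven_integral n \<in> \<int> \<and>
      of_int q ^ Suc n * niven_integral (Suc n) \<in> \<int>" for n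
  proof (induction n)
    case 0
    then show ?case
      using niven_integral_0 niven_integral_1 by simp
  next
    case (Suc n)
    have "of_int q ^ Suc (Suc n) * niven_integral (Suc (Suc n))
        = of_int (q * (4 * int n + 6)) * (of_int q ^ Suc n * niven_integral (Suc n))
          - of_int (p\<^sup>2) * (of_int q ^ n * niven_integral n)"
      unfolding niven_integral_rec by (simp add: p algebra_simps power2_eq_square)
    with Suc show ?case
      by (metis Ints_diff Ints_mult Ints_of_int)
  qed
  have ge_1: "of_int q ^ n * niven_integral n \<ge> 1" for n
  proof -
    have "of_int q ^ n * niven_integral n > 0"
      using q niven_integral_pos by simp
    with int [of n] show ?thesis
      by (auto elim!: Ints_cases)
  qed
  have "of_int q ^ n * niven_integral n \<le> pi * ((of_int q * pi\<^sup>2) ^ n / fact n)" for n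
    using mult_left_mono [OF niven_integral_le [of n], of "of_int q ^ n"] q
    by (simp add: power_mult_distrib mult_ac)
  with ge_1 have "pi * ((of_int q * pi\<^sup>2) ^ n / fact n) \<ge> 1" for n
    by (meson order_trans)
  moreover have "(\<lambda>n. pi * ((of_int q * pi\<^sup>2) ^ n / fact n)) \<longlonglongrightarrow> pi * 0"
    using summable_LIMSEQ_zero [OF summable_exp [of "of_int q * pi\<^sup>2"]]
    by (intro tendsto_mult tendsto_const) (simp add: field_simps)
  ultimately have "(1::real) \<le> pi * 0"
    by (intro LIMSEQ_le_const) auto
  then show False
    by simp
qed

text \<open>
  Kronecker's theorem is about fractional parts, so angles are measured in full turns, by the factor
  \<open>\<theta> = 1 / (2\<pi>)\<close>. The function \<open>frac\<close> jumps at the integers, but only the continuity of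
  \<open>x \<mapsto> cos (2\<pi> x)\<close> and \<open>x \<mapsto> sin (2\<pi> x)\<close> is needed to go back from turns to angles.
\<close>

lemma nat_angle_approx:
  obtains n :: "nat \<Rightarrow> nat" where
    "(\<lambda>k. cos (real (n k))) \<longlonglongrightarrow> cos t" "(\<lambda>k. sin (real (n k))) \<longlonglongrightarrow> sin t"
proof -
  define \<theta> :: real where "\<theta> = 1 / (2 * pi)"
  have "\<theta> \<notin> \<rat>"
  proof
    assume "\<theta> \<in> \<rat>"
    then have "1 / (2 * \<theta>) \<in> \<rat>"
      by (intro Rats_divide Rats_mult) auto
    then show False
      using pi_irrational by (simp add: \<theta>_def)
  qed
  then have "closure (range (\<lambda>n. frac (real n * \<theta>))) = {0..1}"
    by (rule Kronecker_approx_1)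
  moreover have "frac (t * \<theta>) \<in> {0..1}"
    using frac_ge_0 frac_lt_1 [of "t * \<theta>"] by (auto intro: less_imp_le)
  ultimately have "frac (t * \<theta>) \<in> closure (range (\<lambda>n. frac (real n * \<theta>)))"
    by simp
  then obtain f where f: "\<And>k. f k \<in> range (\<lambda>n. frac (real n * \<theta>))" "f \<longlonglongrightarrow> frac (t * \<theta>)"
    by (auto simp: closure_sequential)
  then have "\<forall>k. \<exists>m. f k = frac (real m * \<theta>)"
    by auto
  then obtain n :: "nat \<Rightarrow> nat" where n: "\<And>k. f k = frac (real (n k) * \<theta>)"
    by (auto dest: choice)
  have angle: "2 * pi * frac (s * \<theta>) = s - 2 * pi * of_int \<lfloor>s * \<theta>\<rfloor>" for s
    by (simp add: frac_def \<theta>_def algebra_simps)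
  have per: "cos (2 * pi * frac (s * \<theta>)) = cos s" "sin (2 * pi * frac (s * \<theta>)) = sin s" for s
    unfolding angle by (simp_all add: cos_diff sin_diff)
  have "(\<lambda>k. cos (2 * pi * f k)) \<longlonglongrightarrow> cos (2 * pi * frac (t * \<theta>))"
    "(\<lambda>k. sin (2 * pi * f k)) \<longlonglongrightarrow> sin (2 * pi * frac (t * \<theta>))"
    by (intro tendsto_intros f)+
  then show thesis
    unfolding n per by (rule that)
qed

lemma alg_converges_flow_alg:
  assumes "(\<lambda>k. cos (s k)) \<longlonglongrightarrow> cos t" "(\<lambda>k. sin (s k)) \<longlonglongrightarrow> sin t"
  shows "alg_converges (\<lambda>k. flow_alg a b c d (s k)) (flow_alg a b c d t)"
  unfolding alg_converges_def flow_alg_def struct_const_alg_of_consts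
  by (simp add: forall_2 flow_consts_def)
     (intro conjI tendsto_const tendsto_add tendsto_diff tendsto_minus tendsto_mult assms)

theorem proposition7:
  fixes a b c d :: real
  shows "\<forall>\<alpha>\<in>{-1..1}. \<forall>B\<in>sin_algs a b c d \<alpha>.
           \<exists>n :: nat \<Rightarrow> nat. alg_converges (\<lambda>k. flow_alg a b c d (real (n k))) B"
proof (intro ballI)
  fix \<alpha> B
  assume "B \<in> sin_algs a b c d \<alpha>"
  then obtain t where t: "B = flow_alg a b c d t"
    by (auto simp: sin_algs_def)
  obtain n :: "nat \<Rightarrow> nat" where
    "(\<lambda>k. cos (real (n k))) \<longlonglongrightarrow> cos t" "(\<lambda>k. sin (real (n k))) \<longlonglongrightarrow> sin t"
    by (rule nat_angle_approx)
  then show "\<exists>n :: nat \<Rightarrow> nat. alg_converges (\<lambda>k. flow_alg a b c d (real (n k))) B"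
    unfolding t by (intro exI alg_converges_flow_alg)
qed

end
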